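(* Let $G=G(A,B)$ be a finite bipartite graph with bipartition $(A,B)$ and $|A|\leqslant|B|$. Then $$mp_f(G)=\min\left\{\left.\frac{e(X,Y)}{|X|+|Y|-|A|}\ \right|\ X\subseteq A,\ Y\subseteq B,\ |X|+|Y|-|A|>0\right\}.$$ Furthermore, for every $X\subseteq A$ and $Y\subseteq B$ with $|X|+|Y|-|A|>0$ and $mp_f(G)=\frac{e(X,Y)}{|X|+|Y|-|A|}$, the vector $\widetilde{\bm{y}}\in\mathbb{R}^{E(G)}$ defined by $\widetilde{y}_e=\frac{1}{|X|+|Y|-|A|}$ if $e\in E(X,Y)$ and $\widetilde{y}_e=0$ otherwise is an optimal solution of (FMP).
   Context: $E(X,Y)$ denotes the set of edges with one end in $X$ and the other in $Y$, and $e(X,Y)=|E(X,Y)|$. Let $\mathcal{M}(G)$ be the set of perfect matchings of $G$ and $\bm{q}^M\in\mathbb{R}^{E(G)}$ the incidence vector of $M$. (FMP) is the linear program: minimize $\bm{1}^T\bm{y}$ over $\bm{y}\in\mathbb{R}^{E(G)}$ subject to $(\bm{q}^M)^T\bm{y}\geqslant 1$ for every $M\in\mathcal{M}(G)$ and $y_e\geqslant 0$ for every $e\in E(G)$; its optimal value is the fractional matching preclusion number $mp_f(G)$. *)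

theory Defs
  imports Complex_Main "HOL-Library.Indicator_Function"
begin

definition finite_simple_graph :: "'a set \<Rightarrow> 'a set set \<Rightarrow> bool" where
  "finite_simple_graph V E \<longleftrightarrow> finite V \<and> (\<forall>e\<in>E. e \<subseteq> V \<and> card e = 2)"

definition bipartition :: "'a set \<Rightarrow> 'a set set \<Rightarrow> 'a set \<Rightarrow> 'a set \<Rightarrow> bool" where
  "bipartition V E A B \<longleftrightarrow> A \<union> B = V \<and> A \<inter> B = {} \<and> (\<forall>e\<in>E. \<exists>a\<in>A. \<exists>b\<in>B. e = {a, b})"

definition edges_between :: "'a set set \<Rightarrow> 'a set \<Rightarrow> 'a set \<Rightarrow> 'a set set" where
  "edges_between E X Y = {e \<in> E. \<exists>x\<in>X. \<exists>y\<in>Y. e = {x, y}}"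

definition matching :: "'a set set \<Rightarrow> 'a set set \<Rightarrow> bool" where
  "matching E M \<longleftrightarrow> M \<subseteq> E \<and> (\<forall>e\<in>M. \<forall>f\<in>M. e \<noteq> f \<longrightarrow> e \<inter> f = {})"

definition perfect_matchings :: "'a set \<Rightarrow> 'a set set \<Rightarrow> 'a set set set" where
  "perfect_matchings V E = {M. matching E M \<and> (\<forall>v\<in>V. \<exists>e\<in>M. v \<in> e)}"

text \<open>Vectors indexed by the edges are functions on \<^typ>\<open>'a set\<close> of which only the values
  on \<open>E\<close> matter; the incidence vector of \<open>M\<close> is \<open>indicat_real M\<close>.\<close>

definition fmp_feasible :: "'a set \<Rightarrow> 'a set set \<Rightarrow> ('a set \<Rightarrow> real) \<Rightarrow> bool" where
  "fmp_feasible V E y \<longleftrightarrow>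
     (\<forall>M\<in>perfect_matchings V E. (\<Sum>e\<in>E. indicat_real M e * y e) \<ge> 1) \<and> (\<forall>e\<in>E. y e \<ge> 0)"

definition fmp_objective :: "'a set set \<Rightarrow> ('a set \<Rightarrow> real) \<Rightarrow> real" where
  "fmp_objective E y = (\<Sum>e\<in>E. y e)"

definition fmp_optimal :: "'a set \<Rightarrow> 'a set set \<Rightarrow> ('a set \<Rightarrow> real) \<Rightarrow> bool" where
  "fmp_optimal V E y \<longleftrightarrow>
     fmp_feasible V E y \<and> (\<forall>z. fmp_feasible V E z \<longrightarrow> fmp_objective E y \<le> fmp_objective E z)"

text \<open>The objective is bounded below by \<open>0\<close>, and for \<open>V \<noteq> {}\<close> the all-ones vector is feasible,
  so the infimum below is that of a nonempty set that is bounded below. For the null graph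
  the program is infeasible and the value is meaningless.\<close>

definition mp_f :: "'a set \<Rightarrow> 'a set set \<Rightarrow> real" where
  "mp_f V E = Inf {fmp_objective E y | y. fmp_feasible V E y}"

text \<open>\<open>|X| + |Y| - |A|\<close> as an integer, to avoid truncated subtraction.\<close>

definition excess :: "'a set \<Rightarrow> 'a set \<Rightarrow> 'a set \<Rightarrow> int" where
  "excess A X Y = int (card X) + int (card Y) - int (card A)"

end

theory Submission
  imports Defs "HOL-Analysis.Analysis" "HOL-Combinatorics.Cycles"
begin

text \<open>
  Counting the edges of a perfect matching that lie in \<open>E(X, Y)\<close> shows that each vector
  \<open>1 / (|X| + |Y| - |A|)\<close> on \<open>E(X, Y)\<close> is feasible, so the ratios bound the optimum from above.
  If \<open>|A| < |B|\<close>, the ratio for \<open>X = {}\<close>, \<open>Y = B\<close> is \<open>0\<close>.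
  If \<open>|A| = |B|\<close> and \<open>y\<close> is feasible, duality for the assignment problem gives potentials with
  \<open>u a + v b \<le> y {a, b}\<close> and total at least \<open>1\<close>; hence the objective is at least the sum of
  the positive parts of \<open>u a + v b\<close> over the edges. That sum is the integral over \<open>t\<close> of
  \<open>e(X, Y)\<close> with \<open>X = {a. t \<le> u a}\<close> and \<open>Y = {b. - v b \<le> t}\<close>, and \<open>u\<close>, \<open>v\<close> have
  the integral of \<open>|X| + |Y| - |A|\<close> as their total. The potentials are minimal walk weights
  in the residual digraph of a cheapest bijection, which has no negative cycle.
\<close>

section \<open>Walk weights, potentials and duality for the assignment problem\<close>

fun walk_weight :: "('a \<Rightarrow> 'a \<Rightarrow> real) \<Rightarrow> 'a list \<Rightarrow> real" where
  "walk_weight w (x # y # zs) = w x y + walk_weight w (y # zs)"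
| "walk_weight w _ = 0"

lemma walk_weight_append:
  "walk_weight w (ys @ a # zs) = walk_weight w (ys @ [a]) + walk_weight w (a # zs)"
proof (induction ys)
  case (Cons y ys)
  then show ?case by (cases ys) auto
qed simp

lemma sum_list_map2_eq_walk_weight:
  "sum_list (map2 w (a # ys) (ys @ [z])) = walk_weight w (a # ys @ [z])"
  by (induction ys arbitrary: a) auto

text \<open>The cyclic permutation along \<open>a # ys\<close> fixes all other points of
  \<open>A\<close>, which contribute 0 by \<open>diag\<close>. Its total over \<open>A\<close> is
  therefore the weight of the closed walk.\<close>

lemma closed_walk_weight_nonneg:
  assumes fin: "finite A"
    and perm: "\<And>\<pi>. \<pi> permutes A \<Longrightarrow> 0 \<le> (\<Sum>a\<in>A. w a (\<pi> a))"
    and diag: "\<And>a. a \<in> A \<Longrightarrow> w a a = 0"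
    and dist: "distinct (a # ys)" and sub: "set (a # ys) \<subseteq> A"
  shows "0 \<le> walk_weight w (a # ys @ [a])"
proof -
  let ?cs = "a # ys"
  let ?\<pi> = "cycle_of_list ?cs"
  \<comment> \<open>The cycle shifts the list by one place, so pairing the entries with their images
    yields the steps of the closed walk, the return to \<open>a\<close> included.\<close>
  have rot: "map ?\<pi> ?cs = ys @ [a]"
    using cyclic_rotation[OF dist, of 1] by simp
  have p: "?\<pi> permutes set ?cs"
    by (rule cycle_permutes)
  have "(\<Sum>x\<in>A. w x (?\<pi> x)) = (\<Sum>x\<in>set ?cs. w x (?\<pi> x))"
  proof (rule sum.mono_neutral_right[OF fin sub], rule ballI)
    fix x assume "x \<in> A - set ?cs"
    then show "w x (?\<pi> x) = 0"
      using diag permutes_not_in[OF p, of x] by auto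
  qed
  also have "\<dots> = sum_list (map (\<lambda>x. w x (?\<pi> x)) ?cs)"
    by (rule sum_list_distinct_conv_sum_set[OF dist, symmetric])
  also have "map (\<lambda>x. w x (?\<pi> x)) ?cs = map2 w ?cs (map ?\<pi> ?cs)"
    by (simp only: zip_map2 zip_same_conv_map map_map) (simp add: o_def)
  also have "sum_list \<dots> = walk_weight w (a # ys @ [a])"
    unfolding rot by (rule sum_list_map2_eq_walk_weight)
  finally show ?thesis
    using perm[OF permutes_subset[OF p sub]] by simp
qed

text \<open>The potential of \<open>a\<close> is the least weight of a simple walk in
  \<open>A\<close> that starts at \<open>a\<close> and may end anywhere. A cheapest simple walk from
  \<open>b\<close>, prefixed by \<open>a\<close>, is either simple again or returns to
  \<open>a\<close>; in the latter case the cycle can be cut out without raising the weight.\<close>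

lemma no_negative_cycle_potential:
  fixes w :: "'a \<Rightarrow> 'a \<Rightarrow> real"
  assumes fin: "finite A"
    and perm: "\<And>\<pi>. \<pi> permutes A \<Longrightarrow> 0 \<le> (\<Sum>a\<in>A. w a (\<pi> a))"
    and diag: "\<And>a. a \<in> A \<Longrightarrow> w a a = 0"
  obtains p where "\<And>a b. a \<in> A \<Longrightarrow> b \<in> A \<Longrightarrow> p a \<le> w a b + p b"
proof
  define L where "L a = {xs. distinct xs \<and> set xs \<subseteq> A \<and> xs \<noteq> [] \<and> hd xs = a}" for a
  define p where "p a = Min (walk_weight w ` L a)" for a
  have finL: "finite (L a)" for a
    by (rule finite_subset[OF _ finite_subset_distinct[OF fin]]) (auto simp: L_def)
  have p_le: "p a \<le> walk_weight w xs" if "xs \<in> L a" for a xs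
    unfolding p_def using that finL by (intro Min_le) auto
  fix a b assume a: "a \<in> A" and b: "b \<in> A"
  have "[b] \<in> L b"
    using b by (auto simp: L_def)
  then have "p b \<in> walk_weight w ` L b"
    unfolding p_def using finL by (intro Min_in) auto
  then obtain xs where xs: "xs \<in> L b" "p b = walk_weight w xs"
    by auto
  then obtain xs' where xs': "xs = b # xs'"
    by (cases xs) (auto simp: L_def)
  show "p a \<le> w a b + p b"
  proof (cases "a \<in> set xs")
    case False
    then have "a # xs \<in> L a"
      using xs a by (auto simp: L_def)
    from p_le[OF this] show ?thesis
      using xs xs' by simp
  next
    case True
    then obtain ys zs where split: "xs = ys @ a # zs"
      by (meson split_list)
    have d: "distinct xs" "set xs \<subseteq> A"
      using xs by (auto simp: L_def)
    \<comment> \<open>This cycle consists of the step from \<open>a\<close> to \<open>b\<close> and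
      the portion of \<open>xs\<close> up to \<open>a\<close>. For empty \<open>ys\<close> it is a
      loop, as then \<open>b = a\<close>.\<close>
    have "0 \<le> walk_weight w (a # ys @ [a])"
      by (rule closed_walk_weight_nonneg[where A = A]) (use fin perm diag d split in auto)
    also have "\<dots> = w a b + walk_weight w (ys @ [a])"
      using split xs' by (cases ys) (auto simp: diag a)
    finally have "0 \<le> w a b + walk_weight w (ys @ [a])" .
    moreover have "a # zs \<in> L a"
      using d split by (auto simp: L_def)
    ultimately show ?thesis
      using p_le[of "a # zs" a] xs(2) split walk_weight_append[of w ys a zs] by simp
  qed
qed

text \<open>The potentials are tight along a cheapest bijection \<open>h\<close>, so their total is
  the cost of \<open>h\<close>, which is at least \<gamma>.\<close>

lemma assignment_duality:
  fixes c :: "'a \<Rightarrow> 'b \<Rightarrow> real"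
  assumes fin: "finite A" "finite B" and card: "card A = card B"
    and cost: "\<And>h. bij_betw h A B \<Longrightarrow> \<gamma> \<le> (\<Sum>a\<in>A. c a (h a))"
  obtains u v where "\<And>a b. a \<in> A \<Longrightarrow> b \<in> B \<Longrightarrow> u a + v b \<le> c a b"
    and "\<gamma> \<le> (\<Sum>a\<in>A. u a) + (\<Sum>b\<in>B. v b)"
proof -
  obtain g where g: "bij_betw g A B"
    using finite_same_card_bij[OF fin card] by blast
  \<comment> \<open>The competing bijections are \<open>g\<close> after a permutation of
    \<open>A\<close>; there are finitely many, so a cheapest one exists.\<close>
  let ?cost = "\<lambda>\<pi>. \<Sum>a\<in>A. c a (g (\<pi> a))"
  have "finite {\<pi>. \<pi> permutes A}" "{\<pi>. \<pi> permutes A} \<noteq> {}"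
    using finite_permutations[OF fin(1)] permutes_id[of A] by blast+
  then obtain \<pi> where \<pi>: "\<pi> permutes A"
    and min: "\<And>\<rho>. \<rho> permutes A \<Longrightarrow> ?cost \<pi> \<le> ?cost \<rho>"
    using ex_is_arg_min_if_finite[of "{\<pi>. \<pi> permutes A}" ?cost]
    unfolding is_arg_min_linorder mem_Collect_eq by blast
  define h where "h = g \<circ> \<pi>"
  have h: "bij_betw h A B"
    unfolding h_def using permutes_imp_bij[OF \<pi>] g by (rule bij_betw_trans)
  \<comment> \<open>The change in cost when \<open>a\<close> takes over the partner of
    \<open>b\<close>: the residual digraph with each matched pair contracted to its end in
    \<open>A\<close>. Along a permutation \<rho> the changes add up to the cost of
    \<open>h \<circ> \<rho>\<close> minus that of \<open>h\<close>, which is nonnegative.\<close>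
  define w where "w a b = c a (h b) - c a (h a)" for a b
  obtain p where p: "\<And>a b. a \<in> A \<Longrightarrow> b \<in> A \<Longrightarrow> p a \<le> w a b + p b"
  proof (rule no_negative_cycle_potential[OF fin(1)])
    fix \<rho> assume "\<rho> permutes A"
    then show "0 \<le> (\<Sum>a\<in>A. w a (\<rho> a))"
      using min[OF permutes_compose[OF _ \<pi>]] by (simp add: w_def h_def sum_subtractf)
  qed (auto simp: w_def)
  define u where "u a = c a (h a) + p a" for a
  define v where "v b = - p (inv_into A h b)" for b
  have v_h: "v (h a) = - p a" if "a \<in> A" for a
    using h that by (simp add: v_def bij_betw_inv_into_left)
  show ?thesis
  proof
    fix a b assume a: "a \<in> A" and "b \<in> B"
    then obtain a' where "a' \<in> A" "b = h a'"
      using h by (auto simp: bij_betw_def)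
    then show "u a + v b \<le> c a b"
      using p[OF a, of a'] by (simp add: v_h u_def w_def)
  next
    have "(\<Sum>b\<in>B. v b) = (\<Sum>a\<in>A. v (h a))"
      by (rule sum.reindex_bij_betw[OF h, symmetric])
    also have "\<dots> = - (\<Sum>a\<in>A. p a)"
      by (simp add: v_h sum_negf)
    finally show "\<gamma> \<le> (\<Sum>a\<in>A. u a) + (\<Sum>b\<in>B. v b)"
      using cost[OF h] by (simp add: u_def sum.distrib)
  qed
qed

section \<open>Integration over threshold sets\<close>

lemma interval_indicator_has_integral:
  fixes a b :: real
  assumes "{a..b} \<subseteq> {c..d}"
  shows "((\<lambda>t. if t \<in> {a..b} then 1 else 0) has_integral max 0 (b - a)) {c..d}"
  using has_integral_const_real[of "1::real" a b] has_integral_restrict[OF assms, of "\<lambda>_. 1::real"]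
  by (simp add: max_def split: if_splits)

text \<open>Integrates \<open>cut\<close> over the threshold \<open>t\<close> at which
  \<open>X\<close> and \<open>Y\<close> are cut off; \<open>s\<close> stands for the negated second
  potential.\<close>

lemma layer_cake_bound:
  fixes u :: "'a \<Rightarrow> real" and s :: "'b \<Rightarrow> real"
  assumes fin: "finite A" "finite B" and card: "card A = card B" and P: "P \<subseteq> A \<times> B"
    and cut: "\<And>X Y. X \<subseteq> A \<Longrightarrow> Y \<subseteq> B \<Longrightarrow>
      k * (real (card X) + real (card Y) - real (card A)) \<le> real (card (P \<inter> X \<times> Y))"
  shows "k * ((\<Sum>a\<in>A. u a) - (\<Sum>b\<in>B. s b)) \<le> (\<Sum>(a, b)\<in>P. max 0 (u a - s b))"
proof -
  \<comment> \<open>All values of \<open>u\<close> and \<open>s\<close> lie in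
    \<open>{-M..M}\<close>, so integrating over this interval loses nothing on the side of the
    pairs.\<close>
  define M where "M = (\<Sum>a\<in>A. \<bar>u a\<bar>) + (\<Sum>b\<in>B. \<bar>s b\<bar>)"
  have uM: "\<bar>u a\<bar> \<le> M" if "a \<in> A" for a
    using member_le_sum[OF that, of "\<lambda>a. \<bar>u a\<bar>"] fin by (simp add: M_def add_increasing2 sum_nonneg)
  have sM: "\<bar>s b\<bar> \<le> M" if "b \<in> B" for b
    using member_le_sum[OF that, of "\<lambda>b. \<bar>s b\<bar>"] fin by (simp add: M_def add_increasing sum_nonneg)
  have finP: "finite P"
    using P fin finite_subset by blast
  let ?I = "\<lambda>l r t. if t \<in> {l..r} then 1 else (0::real)"
  \<comment> \<open>Within \<open>{-M..M}\<close> the conditions \<open>t \<le> u a\<close> and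
    \<open>s b \<le> t\<close> become membership in intervals. In \<open>?g\<close> below, the
    interval of a pair is empty if \<open>u a < s b\<close>, which is why positive parts
    arise.\<close>
  let ?f = "\<lambda>t. k * ((\<Sum>a\<in>A. ?I (-M) (u a) t) + (\<Sum>b\<in>B. ?I (s b) M t) - real (card A))"
  let ?g = "\<lambda>t. \<Sum>p\<in>P. ?I (s (snd p)) (u (fst p)) t"
  have f: "(?f has_integral k * ((\<Sum>a\<in>A. max 0 (u a - (-M))) + (\<Sum>b\<in>B. max 0 (M - s b))
      - 2 * M * real (card A))) {-M..M}"
  proof (intro has_integral_mult_right has_integral_diff has_integral_add has_integral_sum fin
      interval_indicator_has_integral)
    have "M \<ge> 0"
      by (simp add: M_def sum_nonneg)
    then show "((\<lambda>t. real (card A)) has_integral 2 * M * real (card A)) {- M..M}"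
      using has_integral_const_real[of "real (card A)" "-M" M] by simp
  next
    fix a assume "a \<in> A"
    then show "{-M..u a} \<subseteq> {-M..M}"
      using uM[of a] by auto
  next
    fix b assume "b \<in> B"
    then show "{s b..M} \<subseteq> {-M..M}"
      using sM[of b] by auto
  qed
  have g: "(?g has_integral (\<Sum>p\<in>P. max 0 (u (fst p) - s (snd p)))) {-M..M}"
  proof (intro has_integral_sum finP interval_indicator_has_integral)
    fix p assume "p \<in> P"
    then have "fst p \<in> A" "snd p \<in> B"
      using P by auto
    then show "{s (snd p)..u (fst p)} \<subseteq> {-M..M}"
      using uM[of "fst p"] sM[of "snd p"] by auto
  qed
  have "?f t \<le> ?g t" if t: "t \<in> {-M..M}" for t
  proof -
    define X where "X = {a\<in>A. t \<le> u a}"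
    define Y where "Y = {b\<in>B. s b \<le> t}"
    have "(\<Sum>a\<in>A. ?I (-M) (u a) t) = real (card X)"
      using t fin by (simp add: X_def sum.If_cases Int_def)
    moreover have "(\<Sum>b\<in>B. ?I (s b) M t) = real (card Y)"
      using t fin by (simp add: Y_def sum.If_cases Int_def)
    moreover have "?g t = real (card (P \<inter> X \<times> Y))"
    proof -
      have "P \<inter> {p. t \<in> {s (snd p)..u (fst p)}} = P \<inter> X \<times> Y"
        using P by (auto simp: X_def Y_def)
      then show ?thesis
        using finP by (simp add: sum.If_cases)
    qed
    ultimately show ?thesis
      using cut[of X Y] by (simp add: X_def Y_def)
  qed
  from has_integral_le[OF f g this]
  have "k * ((\<Sum>a\<in>A. max 0 (u a - (-M))) + (\<Sum>b\<in>B. max 0 (M - s b)) - 2 * M * real (card A))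
    \<le> (\<Sum>p\<in>P. max 0 (u (fst p) - s (snd p)))"
    by blast
  moreover have "(\<Sum>a\<in>A. max 0 (u a - (-M))) = (\<Sum>a\<in>A. u a + M)"
    by (rule sum.cong) (use uM in \<open>force+\<close>)
  moreover have "(\<Sum>b\<in>B. max 0 (M - s b)) = (\<Sum>b\<in>B. M - s b)"
    by (rule sum.cong) (use sM in \<open>force+\<close>)
  \<comment> \<open>The terms in \<open>M\<close> cancel because
    \<open>card A = card B\<close>.\<close>
  ultimately show ?thesis
    using card by (simp add: sum.distrib sum_subtractf case_prod_unfold algebra_simps)
qed

section \<open>Perfect matchings in bipartite graphs and feasible cut vectors\<close>

lemma card_disjoint_sets_meeting_le:
  assumes "finite S" and disj: "\<And>e f. e \<in> M \<Longrightarrow> f \<in> M \<Longrightarrow> e \<noteq> f \<Longrightarrow> e \<inter> f = {}"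
  shows "card {e\<in>M. e \<inter> S \<noteq> {}} \<le> card S"
proof -
  have "\<exists>x. x \<in> e \<inter> S" if "e \<in> {e\<in>M. e \<inter> S \<noteq> {}}" for e
    using that by auto
  then obtain r where r: "\<And>e. e \<in> {e\<in>M. e \<inter> S \<noteq> {}} \<Longrightarrow> r e \<in> e \<inter> S"
    by metis
  have "inj_on r {e\<in>M. e \<inter> S \<noteq> {}}"
  proof (rule inj_onI)
    fix e f assume ef: "e \<in> {e\<in>M. e \<inter> S \<noteq> {}}" "f \<in> {e\<in>M. e \<inter> S \<noteq> {}}" and "r e = r f"
    then have "r e \<in> e \<inter> f"
      using r[of e] r[of f] by auto
    then show "e = f"
      using disj[of e f] ef by blast
  qed
  moreover have "r ` {e\<in>M. e \<inter> S \<noteq> {}} \<subseteq> S"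
    using r by auto
  ultimately show ?thesis
    using card_inj_on_le assms(1) by blast
qed

locale bipartite_graph =
  fixes V A B :: "'a set" and E :: "'a set set"
  assumes graph: "finite_simple_graph V E" and bip: "bipartition V E A B"
begin

lemma finite_parts: "finite A" "finite B"
  using graph bip by (auto simp: finite_simple_graph_def bipartition_def)

lemma parts_disjoint: "a \<in> A \<Longrightarrow> b \<in> B \<Longrightarrow> a \<noteq> b"
  using bip by (auto simp: bipartition_def)

lemma finite_edges: "finite E"
proof -
  have "finite V" "E \<subseteq> Pow V"
    using graph by (auto simp: finite_simple_graph_def)
  then show ?thesis
    using finite_subset by blast
qed

lemma edgeE:
  assumes "e \<in> E"
  obtains a b where "a \<in> A" "b \<in> B" "e = {a, b}"
  using assms bip by (auto simp: bipartition_def)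

text \<open>Orients each edge from \<open>A\<close> to \<open>B\<close>, so that potentials on the
  two sides can be evaluated at its ends. Disjointness of the parts makes the orientation
  unique.\<close>

definition edge_pairs :: "('a \<times> 'a) set" where
  "edge_pairs = {(a, b). a \<in> A \<and> b \<in> B \<and> {a, b} \<in> E}"

lemma edge_pairs_bij: "bij_betw (\<lambda>(a, b). {a, b}) edge_pairs E"
  unfolding bij_betw_def
proof
  show "inj_on (\<lambda>(a, b). {a, b}) edge_pairs"
    using parts_disjoint by (auto simp: inj_on_def edge_pairs_def doubleton_eq_iff)
  show "(\<lambda>(a, b). {a, b}) ` edge_pairs = E"
  proof (intro equalityI subsetI)
    fix e assume "e \<in> E"
    moreover then obtain a b where "a \<in> A" "b \<in> B" "e = {a, b}"
      by (rule edgeE)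
    ultimately have "(a, b) \<in> edge_pairs" "e = (\<lambda>(a, b). {a, b}) (a, b)"
      by (auto simp: edge_pairs_def)
    then show "e \<in> (\<lambda>(a, b). {a, b}) ` edge_pairs"
      by (rule rev_image_eqI)
  qed (auto simp: edge_pairs_def)
qed

lemma card_edges_between:
  assumes "X \<subseteq> A" "Y \<subseteq> B"
  shows "card (edges_between E X Y) = card (edge_pairs \<inter> X \<times> Y)"
proof -
  have "edges_between E X Y = (\<lambda>(a, b). {a, b}) ` (edge_pairs \<inter> X \<times> Y)"
    using assms by (fastforce simp: edges_between_def edge_pairs_def)
  moreover have "inj_on (\<lambda>(a, b). {a, b}) (edge_pairs \<inter> X \<times> Y)"
    using inj_on_subset[OF bij_betw_imp_inj_on[OF edge_pairs_bij]] by blast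
  ultimately show ?thesis
    by (simp add: card_image)
qed

text \<open>An edge of \<open>M\<close> outside \<open>E(X, Y)\<close> meets \<open>A - X\<close> or
  \<open>B - Y\<close>. As \<open>M\<close> is a matching, there are at most
  \<open>|A| - |X| + |B| - |Y|\<close> such edges, while \<open>M\<close> has at least
  \<open>|B|\<close> edges.\<close>

lemma perfect_matching_edges_between:
  assumes M: "M \<in> perfect_matchings V E" and XY: "X \<subseteq> A" "Y \<subseteq> B"
  shows "excess A X Y \<le> int (card (M \<inter> edges_between E X Y))"
proof -
  have ME: "M \<subseteq> E" and disj: "\<And>e f. e \<in> M \<Longrightarrow> f \<in> M \<Longrightarrow> e \<noteq> f \<Longrightarrow> e \<inter> f = {}"
    and cover: "\<And>v. v \<in> B \<Longrightarrow> \<exists>e\<in>M. v \<in> e"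
    using M bip by (auto simp: perfect_matchings_def matching_def bipartition_def)
  have finM: "finite M"
    using ME finite_edges finite_subset by blast
  obtain g where g: "\<And>b. b \<in> B \<Longrightarrow> g b \<in> M \<and> b \<in> g b"
    using cover by metis
  \<comment> \<open>An edge has only one end in \<open>B\<close>, so distinct vertices of
    \<open>B\<close> are covered by distinct edges.\<close>
  have "inj_on g B"
  proof (rule inj_onI)
    fix b b' assume b: "b \<in> B" "b' \<in> B" and "g b = g b'"
    then have "g b \<in> E" "b \<in> g b" "b' \<in> g b"
      using g ME by auto
    then show "b = b'"
      using b parts_disjoint by (elim edgeE) auto
  qed
  then have "card B \<le> card M"
    using g finM by (intro card_inj_on_le) auto
  moreover have "M \<subseteq> (M \<inter> edges_between E X Y) \<union>
      ({e\<in>M. e \<inter> (A - X) \<noteq> {}} \<union> {e\<in>M. e \<inter> (B - Y) \<noteq> {}})"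
  proof
    fix e assume e: "e \<in> M"
    then obtain a b where "a \<in> A" "b \<in> B" "e = {a, b}"
      using ME edgeE[of e] by blast
    then show "e \<in> (M \<inter> edges_between E X Y) \<union>
      ({e\<in>M. e \<inter> (A - X) \<noteq> {}} \<union> {e\<in>M. e \<inter> (B - Y) \<noteq> {}})"
      using e ME by (auto simp: edges_between_def)
  qed
  then have "card M \<le> card ((M \<inter> edges_between E X Y) \<union>
      ({e\<in>M. e \<inter> (A - X) \<noteq> {}} \<union> {e\<in>M. e \<inter> (B - Y) \<noteq> {}}))"
    using finM by (intro card_mono) auto
  then have "card M \<le> card (M \<inter> edges_between E X Y) +
      (card {e\<in>M. e \<inter> (A - X) \<noteq> {}} + card {e\<in>M. e \<inter> (B - Y) \<noteq> {}})"
    by (meson add_left_mono card_Un_le order_trans)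
  moreover have "card {e\<in>M. e \<inter> (A - X) \<noteq> {}} \<le> card (A - X)"
    using finite_parts disj by (intro card_disjoint_sets_meeting_le) auto
  moreover have "card {e\<in>M. e \<inter> (B - Y) \<noteq> {}} \<le> card (B - Y)"
    using finite_parts disj by (intro card_disjoint_sets_meeting_le) auto
  moreover have "card (A - X) = card A - card X" "card (B - Y) = card B - card Y"
    "card X \<le> card A" "card Y \<le> card B"
    using XY finite_parts by (simp_all add: card_Diff_subset card_mono finite_subset)
  ultimately show ?thesis
    by (simp add: excess_def)
qed

abbreviation cut_vector :: "'a set \<Rightarrow> 'a set \<Rightarrow> 'a set \<Rightarrow> real" where
  "cut_vector X Y \<equiv>
    (\<lambda>e. if e \<in> edges_between E X Y then 1 / real_of_int (excess A X Y) else 0)"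

lemma cut_vector_feasible:
  assumes XY: "X \<subseteq> A" "Y \<subseteq> B" and pos: "0 < excess A X Y"
  shows "fmp_feasible V E (cut_vector X Y)"
  unfolding fmp_feasible_def
proof (intro conjI ballI)
  fix M assume M: "M \<in> perfect_matchings V E"
  have ME: "M \<subseteq> E"
    using M by (auto simp: perfect_matchings_def matching_def)
  have "(\<Sum>e\<in>E. indicat_real M e * cut_vector X Y e) =
      (\<Sum>e\<in>E. if e \<in> M \<inter> edges_between E X Y then 1 / real_of_int (excess A X Y) else 0)"
    by (rule sum.cong) (auto simp: indicator_def)
  also have "\<dots> = real (card (M \<inter> edges_between E X Y)) / real_of_int (excess A X Y)"
  proof -
    have "E \<inter> {e. e \<in> M \<inter> edges_between E X Y} = M \<inter> edges_between E X Y"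
      using ME by auto
    then show ?thesis
      using finite_edges by (simp only: sum.If_cases) simp
  qed
  also have "\<dots> \<ge> 1"
    using perfect_matching_edges_between[OF M XY] pos by (simp add: field_simps)
  finally show "1 \<le> (\<Sum>e\<in>E. indicat_real M e * cut_vector X Y e)" .
qed (use pos in auto)

lemma cut_vector_objective:
  "fmp_objective E (cut_vector X Y) = real (card (edges_between E X Y)) / real_of_int (excess A X Y)"
proof -
  have "edges_between E X Y \<subseteq> E"
    by (auto simp: edges_between_def)
  then show ?thesis
    using finite_edges by (simp add: fmp_objective_def sum.If_cases Int_absorb1)
qed

section \<open>The lower bound for parts of equal size\<close>

lemma bij_betw_perfect_matching:
  assumes h: "bij_betw h A B" and edges: "\<And>a. a \<in> A \<Longrightarrow> {a, h a} \<in> E"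
  shows "(\<lambda>a. {a, h a}) ` A \<in> perfect_matchings V E" and "inj_on (\<lambda>a. {a, h a}) A"
proof -
  have inB: "h a \<in> B" if "a \<in> A" for a
    using h that by (auto simp: bij_betw_def)
  have ne: "a \<noteq> h a'" if "a \<in> A" "a' \<in> A" for a a'
    using parts_disjoint inB that by blast
  have inj: "h a = h a' \<longleftrightarrow> a = a'" if "a \<in> A" "a' \<in> A" for a a'
    using h that by (auto simp: bij_betw_def inj_on_def)
  have "matching E ((\<lambda>a. {a, h a}) ` A)"
    unfolding matching_def
  proof (intro conjI ballI impI)
    fix e f assume "e \<in> (\<lambda>a. {a, h a}) ` A" "f \<in> (\<lambda>a. {a, h a}) ` A" and "e \<noteq> f"
    then obtain a a' where "a \<in> A" "a' \<in> A" "e = {a, h a}" "f = {a', h a'}" "a \<noteq> a'"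
      by blast
    then show "e \<inter> f = {}"
      using ne[of a a'] ne[of a' a] inj[of a a'] by auto
  qed (use edges in auto)
  moreover have "\<exists>e\<in>(\<lambda>a. {a, h a}) ` A. v \<in> e" if "v \<in> V" for v
    using that bip h by (auto simp: bipartition_def bij_betw_def)
  ultimately show "(\<lambda>a. {a, h a}) ` A \<in> perfect_matchings V E"
    by (simp add: perfect_matchings_def)
  show "inj_on (\<lambda>a. {a, h a}) A"
    using ne by (auto simp: inj_on_def doubleton_eq_iff)
qed

text \<open>Meant for \<open>k\<close> the least ratio. The bound \<open>cut\<close> is asked of all
  \<open>X\<close> and \<open>Y\<close>, whatever the sign of the excess, because the threshold sets
  in the integral are not under control.\<close>

lemma fmp_objective_lower_bound:
  assumes card: "card A = card B" and y: "fmp_feasible V E y"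
    and cut: "\<And>X Y. X \<subseteq> A \<Longrightarrow> Y \<subseteq> B \<Longrightarrow>
      k * real_of_int (excess A X Y) \<le> real (card (edges_between E X Y))"
    and k: "0 \<le> k"
  shows "k \<le> fmp_objective E y"
proof -
  \<comment> \<open>Cost 1 on the non-edges keeps every bijection of cost at least 1, since \<open>y \<ge> 0\<close>.\<close>
  define c where "c a b = (if {a, b} \<in> E then y {a, b} else 1)" for a b
  have y0: "0 \<le> y e" if "e \<in> E" for e
    using y that by (auto simp: fmp_feasible_def)
  have c0: "0 \<le> c a b" for a b
    using y0 by (auto simp: c_def)
  have cost: "1 \<le> (\<Sum>a\<in>A. c a (h a))" if h: "bij_betw h A B" for h
  proof (cases "\<forall>a\<in>A. {a, h a} \<in> E")
    case True
    let ?M = "(\<lambda>a. {a, h a}) ` A"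
    have M: "?M \<in> perfect_matchings V E" and inj: "inj_on (\<lambda>a. {a, h a}) A"
      using bij_betw_perfect_matching[OF h] True by auto
    have "1 \<le> (\<Sum>e\<in>E. indicat_real ?M e * y e)"
      using y M by (auto simp: fmp_feasible_def)
    also have "\<dots> = (\<Sum>e\<in>?M. y e)"
    proof -
      have "(\<Sum>e\<in>E. indicat_real ?M e * y e) = (\<Sum>e\<in>E \<inter> ?M. y e)"
        using finite_edges by (simp add: sum.inter_restrict indicator_def if_distrib cong: if_cong)
      moreover have "E \<inter> ?M = ?M"
        using True by auto
      ultimately show ?thesis
        by simp
    qed
    also have "\<dots> = (\<Sum>a\<in>A. c a (h a))"
      using True by (simp add: sum.reindex[OF inj] c_def)
    finally show ?thesis .
  next
    case False
    then obtain a where "a \<in> A" "c a (h a) = 1"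
      by (auto simp: c_def)
    then show ?thesis
      using member_le_sum[of a A "\<lambda>a. c a (h a)"] c0 finite_parts by simp
  qed
  obtain u v where uv: "\<And>a b. a \<in> A \<Longrightarrow> b \<in> B \<Longrightarrow> u a + v b \<le> c a b"
    and sum_uv: "1 \<le> (\<Sum>a\<in>A. u a) + (\<Sum>b\<in>B. v b)"
    by (rule assignment_duality[OF finite_parts card, where \<gamma> = 1 and c = c]) (use cost in auto)
  \<comment> \<open>The potential \<open>v\<close> is negated to fit the threshold form
    \<open>u a - s b\<close>.\<close>
  have "k \<le> k * ((\<Sum>a\<in>A. u a) - (\<Sum>b\<in>B. - v b))"
    using mult_left_mono[OF sum_uv k] by (simp add: sum_negf)
  also have "\<dots> \<le> (\<Sum>(a, b)\<in>edge_pairs. max 0 (u a - - v b))"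
    using cut card_edges_between
    by (intro layer_cake_bound finite_parts card) (auto simp: edge_pairs_def excess_def)
  also have "\<dots> \<le> (\<Sum>(a, b)\<in>edge_pairs. y {a, b})"
  proof (rule sum_mono, clarify)
    fix a b assume "(a, b) \<in> edge_pairs"
    then show "max 0 (u a - - v b) \<le> y {a, b}"
      using uv[of a b] y0[of "{a, b}"] by (auto simp: edge_pairs_def c_def)
  qed
  also have "\<dots> = fmp_objective E y"
    using sum.reindex_bij_betw[OF edge_pairs_bij, of y]
    by (simp add: fmp_objective_def case_prod_unfold)
  finally show ?thesis .
qed

end

section \<open>The optimal value as the least ratio\<close>

theorem theorem3p6:
  fixes V A B :: "'a set" and E :: "'a set set"
  assumes "finite_simple_graph V E" and "V \<noteq> {}"
    and "bipartition V E A B" and "card A \<le> card B"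
  shows "mp_f V E =
      Min {real (card (edges_between E X Y)) / real_of_int (excess A X Y) | X Y.
             X \<subseteq> A \<and> Y \<subseteq> B \<and> excess A X Y > 0}
    \<and> (\<forall>X Y. X \<subseteq> A \<and> Y \<subseteq> B \<and> excess A X Y > 0 \<and>
         mp_f V E = real (card (edges_between E X Y)) / real_of_int (excess A X Y) \<longrightarrow>
         fmp_optimal V E
           (\<lambda>e. if e \<in> edges_between E X Y then 1 / real_of_int (excess A X Y) else 0))"
proof -
  interpret bipartite_graph V A B E
    using assms by unfold_locales
  let ?ratio = "\<lambda>X Y. real (card (edges_between E X Y)) / real_of_int (excess A X Y)"
  define R where "R = {?ratio X Y | X Y. X \<subseteq> A \<and> Y \<subseteq> B \<and> excess A X Y > 0}"
  have "R \<subseteq> (\<lambda>(X, Y). ?ratio X Y) ` (Pow A \<times> Pow B)"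
    by (auto simp: R_def)
  then have finR: "finite R"
    using finite_parts by (meson finite_Pow_iff finite_SigmaI finite_imageI finite_subset)
  \<comment> \<open>Here \<open>V \<noteq> {}\<close> and \<open>card A \<le> card B\<close> enter.
    Since \<open>excess A A B = card B\<close>, the pair \<open>A\<close>, \<open>B\<close> is
    admissible and \<open>Min R\<close> is a genuine minimum.\<close>
  have "B \<noteq> {}"
    using assms finite_parts by (auto simp: bipartition_def)
  then have "excess A A B > 0"
    using finite_parts by (simp add: excess_def card_gt_0_iff)
  then have "R \<noteq> {}"
    by (auto simp: R_def)
  then have MinR: "Min R \<in> R"
    using finR by simp
  have Min_le_ratio: "Min R \<le> ?ratio X Y" if "X \<subseteq> A" "Y \<subseteq> B" "excess A X Y > 0" for X Y
    using that finR by (intro Min_le) (auto simp: R_def)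
  have R0: "0 \<le> Min R"
    using MinR by (auto simp: R_def)
  have lower: "Min R \<le> fmp_objective E y" if y: "fmp_feasible V E y" for y
  proof (cases "card A = card B")
    case True
    show ?thesis
    proof (rule fmp_objective_lower_bound[OF True y _ R0])
      fix X Y assume XY: "X \<subseteq> A" "Y \<subseteq> B"
      show "Min R * real_of_int (excess A X Y) \<le> real (card (edges_between E X Y))"
      proof (cases "excess A X Y > 0")
        case True
        then show ?thesis
          using Min_le_ratio[OF XY True] by (simp add: field_simps)
      next
        case False
        then have "Min R * real_of_int (excess A X Y) \<le> 0"
          using R0 by (intro mult_nonneg_nonpos) auto
        then show ?thesis
          by linarith
      qed
    qed
  next
    case False
    then have "excess A {} B > 0"
      using assms(4) by (simp add: excess_def)
    then have "Min R \<le> 0"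
      using Min_le_ratio[of "{}" B] by (simp add: edges_between_def)
    also have "0 \<le> fmp_objective E y"
      using y by (auto simp: fmp_objective_def fmp_feasible_def intro: sum_nonneg)
    finally show ?thesis .
  qed
  have eq: "mp_f V E = Min R"
    unfolding mp_f_def
  proof (rule cInf_eq_minimum)
    \<comment> \<open>The infimum is attained by the cut vector of a pair with the least
      ratio.\<close>
    from MinR obtain X Y where "X \<subseteq> A" "Y \<subseteq> B" "excess A X Y > 0" "Min R = ?ratio X Y"
      by (auto simp: R_def)
    then have "fmp_feasible V E (cut_vector X Y)" "Min R = fmp_objective E (cut_vector X Y)"
      using cut_vector_feasible by (simp_all only: cut_vector_objective)
    then show "Min R \<in> {fmp_objective E y | y. fmp_feasible V E y}"
      by blast
  qed (use lower in auto)
  have "fmp_optimal V E (cut_vector X Y)"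
    if "X \<subseteq> A" "Y \<subseteq> B" "excess A X Y > 0" "mp_f V E = ?ratio X Y" for X Y
    unfolding fmp_optimal_def cut_vector_objective
    using cut_vector_feasible[OF that(1-3)] lower that(4) eq by auto
  with eq show ?thesis
    unfolding R_def by blast
qed

end
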